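(* Let $\mathcal{X}$ be a reflexive and strictly convex Banach space over $\mathbb{F}$ and let $d\ge1$. Let $T,S\in\mathcal{K}(\mathcal{X},\ell_\infty^d)$ with $T=(f_1,\dots,f_d)$ and $S=(g_1,\dots,g_d)$, where $f_i,g_i\in\mathcal{X}^*$ for $1\le i\le d$. Then the following are true. (i) $dist(T,\mathbb{F}^dS)=\max_{1\le i\le d}\|f_i|_{\ker(g_i)}\|$. (ii) If $\|T\|\neq0$, then $T\perp_B\mathbb{F}^dS$ implies that for some $1\le i\le d$, $g_i(x)=0$ for every $x\in M_{f_i}$. (iii) If there is $\lambda\neq0$ with $\|f_i\|=\lambda$ for all $1\le i\le d$, then $T\perp_B\mathbb{F}^dS$ if and only if for some $1\le i\le d$, $g_i(x)=0$ for every $x\in M_{f_i}$.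
   Context: $\mathbb{F}$ is $\mathbb{R}$ or $\mathbb{C}$. $\ell_\infty^d$ is $\mathbb{F}^d$ with the maximum norm. $\mathcal{K}(\mathcal{X},\ell_\infty^d)$ is the space of compact linear operators from $\mathcal{X}$ to $\ell_\infty^d$ with the operator norm; each such $T$ has the form $Tx=(f_1(x),\dots,f_d(x))$ with $f_1,\dots,f_d\in\mathcal{X}^*$, written $T=(f_1,\dots,f_d)$. For $S=(g_1,\dots,g_d)$, $\mathbb{F}^dS=\{(z_1g_1,\dots,z_dg_d):(z_1,\dots,z_d)\in\mathbb{F}^d\}$. For an element $x$ and a subspace $W$ of a Banach space, $dist(x,W)=\inf\{\|x-w\|:w\in W\}$. $\|f_i|_{\ker(g_i)}\|$ is the norm of the restriction of $f_i$ to the subspace $\ker(g_i)$. $\mathcal{X}$ is strictly convex if every point of its unit sphere $S_{\mathcal{X}}$ is an extreme point of its closed unit ball. $M_f=\{x\in S_{\mathcal{X}}:|f(x)|=\|f\|\}$ for $f\in\mathcal{X}^*$. Birkhoff-James orthogonality: for elements $x,y$ of a Banach space, $x\perp_B y$ means $\|x+\lambda y\|\ge\|x\|$ for all $\lambda\in\mathbb{F}$; for a subspace $W$, $x\perp_B W$ means $x\perp_B w$ for all $w\in W$. *)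

theory Defs
  imports "HOL-Analysis.Analysis"
begin

(* The scalar field is the real or the complex numbers, up to an isometric isomorphism; stating
   this as a class lets one statement cover both cases, as in the usual convention "F is R or C". *)
class real_or_complex = real_normed_field +
  assumes real_or_complex:
    "(\<forall>z. \<exists>a. z = a *\<^sub>R 1) \<or>
     (\<exists>i. i * i = - 1 \<and> (\<forall>z. \<exists>a b. z = a *\<^sub>R 1 + b *\<^sub>R i) \<and>
        (\<forall>a b. norm (a *\<^sub>R 1 + b *\<^sub>R i) = sqrt (a\<^sup>2 + b\<^sup>2)))"

instance real :: real_or_complex
  by standard simp

instance complex :: real_or_complex
proof
  have "\<exists>a b. z = a *\<^sub>R 1 + b *\<^sub>R \<i>" for z
    by (rule exI[of _ "Re z"], rule exI[of _ "Im z"]) (simp add: complex_eq_iff)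
  moreover have "norm (a *\<^sub>R 1 + b *\<^sub>R \<i>) = sqrt (a\<^sup>2 + b\<^sup>2)" for a b
    by (simp add: cmod_def)
  ultimately show "(\<forall>z::complex. \<exists>a. z = a *\<^sub>R 1) \<or>
     (\<exists>i::complex. i * i = - 1 \<and> (\<forall>z. \<exists>a b. z = a *\<^sub>R 1 + b *\<^sub>R i) \<and>
        (\<forall>a b. norm (a *\<^sub>R 1 + b *\<^sub>R i) = sqrt (a\<^sup>2 + b\<^sup>2)))"
    by (intro disjI2 exI[of _ "\<i>"]) auto
qed

(* A normed space over F is a real normed space with a scalar multiplication by F that extends the
   real one and makes the norm absolutely homogeneous over F. *)
locale normed_space_over = vector_space smul
  for smul :: "'f::real_or_complex \<Rightarrow> 'x::real_normed_vector \<Rightarrow> 'x" +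
  assumes scale_of_real: "smul (of_real r) x = r *\<^sub>R x"
    and norm_scale: "norm (smul c x) = norm c * norm x"

lemma normed_space_over_scaleR:
  "normed_space_over (scaleR :: real \<Rightarrow> 'x \<Rightarrow> 'x::real_normed_vector)"
  by unfold_locales (simp_all add: scaleR_add_right scaleR_add_left)

lemma normed_space_over_mult:
  "normed_space_over ((*) :: 'f \<Rightarrow> 'f \<Rightarrow> 'f::real_or_complex)"
  by unfold_locales (simp_all add: algebra_simps norm_mult scaleR_conv_of_real)

(* The dimension is the cardinality of the finite (nonempty) index type. *)
typedef (overloaded) ('f, 'd) linf = "UNIV :: ('d::finite \<Rightarrow> 'f::real_normed_vector) set"
  morphisms linf_nth Linf ..

lemma linf_nth_Linf [simp]: "linf_nth (Linf v) i = v i"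
  by (simp add: Linf_inverse)

lemma linf_eq_iff: "u = v \<longleftrightarrow> (\<forall>i. linf_nth u i = linf_nth v i)"
  by (metis ext linf_nth_inject)

instantiation linf :: (real_normed_vector, finite) real_normed_vector
begin

definition "(0 :: ('a, 'b) linf) = Linf (\<lambda>i. 0)"
definition "u + (v :: ('a, 'b) linf) = Linf (\<lambda>i. linf_nth u i + linf_nth v i)"
definition "u - (v :: ('a, 'b) linf) = Linf (\<lambda>i. linf_nth u i - linf_nth v i)"
definition "- (v :: ('a, 'b) linf) = Linf (\<lambda>i. - linf_nth v i)"
definition "scaleR r (v :: ('a, 'b) linf) = Linf (\<lambda>i. r *\<^sub>R linf_nth v i)"
definition norm_linf_def: "norm (v :: ('a, 'b) linf) = (MAX i. norm (linf_nth v i))"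
definition "sgn (v :: ('a, 'b) linf) = scaleR (inverse (norm v)) v"
definition "dist (u :: ('a, 'b) linf) v = norm (u - v)"
definition [code del]: "(uniformity :: (('a, 'b) linf \<times> ('a, 'b) linf) filter) =
  (INF e\<in>{0 <..}. principal {(x, y). dist x y < e})"
definition [code del]: "open (U :: ('a, 'b) linf set) \<longleftrightarrow>
  (\<forall>x\<in>U. \<forall>\<^sub>F (x', y) in uniformity. x' = x \<longrightarrow> y \<in> U)"

instance
proof
  fix a b :: real and u v w :: "('a, 'b) linf"
  note defs = zero_linf_def plus_linf_def minus_linf_def uminus_linf_def scaleR_linf_def
  have nth_le: "norm (linf_nth w i) \<le> norm w" for w :: "('a, 'b) linf" and i
    by (simp add: norm_linf_def)
  have norm_le: "norm w \<le> c" if "\<And>i. norm (linf_nth w i) \<le> c" for w :: "('a, 'b) linf" and c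
    using that by (simp add: norm_linf_def)
  show "u + v + w = u + (v + w)" "u + v = v + u" "0 + u = u" "- u + u = 0" "u - v = u + - v"
    "a *\<^sub>R (u + v) = a *\<^sub>R u + a *\<^sub>R v" "(a + b) *\<^sub>R u = a *\<^sub>R u + b *\<^sub>R u"
    "a *\<^sub>R b *\<^sub>R u = (a * b) *\<^sub>R u" "1 *\<^sub>R u = u"
    by (simp_all add: defs linf_eq_iff algebra_simps)
  show "norm u = 0 \<longleftrightarrow> u = 0"
  proof
    assume "norm u = 0"
    then show "u = 0" using nth_le[of u] by (simp add: defs linf_eq_iff)
  qed (simp add: norm_linf_def defs)
  show "norm (u + v) \<le> norm u + norm v"
    by (rule norm_le) (simp add: defs norm_triangle_mono nth_le)
  show "norm (a *\<^sub>R u) = \<bar>a\<bar> * norm u"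
  proof (rule antisym)
    show "norm (a *\<^sub>R u) \<le> \<bar>a\<bar> * norm u"
      by (rule norm_le) (simp add: defs mult_left_mono nth_le)
    have "norm u \<in> range (\<lambda>i. norm (linf_nth u i))"
      unfolding norm_linf_def by (rule Max_in) auto
    then obtain i where "norm u = norm (linf_nth u i)" by auto
    then show "\<bar>a\<bar> * norm u \<le> norm (a *\<^sub>R u)"
      using nth_le[of "a *\<^sub>R u" i] by (simp add: defs)
  qed
qed (rule sgn_linf_def dist_linf_def uniformity_linf_def open_linf_def)+

end

lemma linf_nth_simps [simp]:
  "linf_nth 0 i = 0"
  "linf_nth (u + v) i = linf_nth u i + linf_nth v i"
  "linf_nth (u - v) i = linf_nth u i - linf_nth v i"
  "linf_nth (- v) i = - linf_nth v i"
  "linf_nth (r *\<^sub>R v) i = r *\<^sub>R linf_nth v i"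
  by (simp_all add: zero_linf_def plus_linf_def minus_linf_def uminus_linf_def scaleR_linf_def)

lemma linf_norm_nth_le: "norm (linf_nth v i) \<le> norm v"
  by (simp add: norm_linf_def)

lemma linf_norm_le: "(\<And>i. norm (linf_nth v i) \<le> c) \<Longrightarrow> norm v \<le> c"
  by (simp add: norm_linf_def)

definition linf_scale ::
    "'f::real_or_complex \<Rightarrow> ('f, 'd::finite) linf \<Rightarrow> ('f, 'd) linf" where
  "linf_scale c v = Linf (\<lambda>i. c * linf_nth v i)"

lemma normed_space_over_linf_scale: "normed_space_over linf_scale"
proof unfold_locales
  fix c :: "'f::real_or_complex" and v :: "('f, 'd::finite) linf"
  show "norm (linf_scale c v) = norm c * norm v"
  proof (rule antisym)
    show "norm (linf_scale c v) \<le> norm c * norm v"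
      by (rule linf_norm_le) (simp add: linf_scale_def norm_mult mult_left_mono linf_norm_nth_le)
    have "norm v \<in> range (\<lambda>i. norm (linf_nth v i))"
      unfolding norm_linf_def by (rule Max_in) auto
    then obtain i where "norm v = norm (linf_nth v i)" by auto
    then show "norm c * norm v \<le> norm (linf_scale c v)"
      using linf_norm_nth_le[of "linf_scale c v" i] by (simp add: linf_scale_def norm_mult)
  qed
qed (simp_all add: linf_scale_def linf_eq_iff algebra_simps scaleR_conv_of_real)

(* Elements of the library's type of bounded linear maps are only real-linear, so linearity over F
   is imposed separately. The norm of that type is the operator norm. *)
definition dual_space ::
    "('f::real_or_complex \<Rightarrow> 'x::real_normed_vector \<Rightarrow> 'x) \<Rightarrow> ('x \<Rightarrow>\<^sub>L 'f) set" where
  "dual_space smul = {f. Vector_Spaces.linear smul (*) (blinfun_apply f)}"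

definition functional_scale ::
    "'f::real_or_complex \<Rightarrow> ('x::real_normed_vector \<Rightarrow>\<^sub>L 'f) \<Rightarrow> ('x \<Rightarrow>\<^sub>L 'f)" where
  "functional_scale c f = blinfun_mult_right c o\<^sub>L f"

(* Every bounded F-linear functional on the dual space is evaluation at some point. Only the values
   of phi on the dual space matter. *)
definition reflexive_space ::
    "('f::real_or_complex \<Rightarrow> 'x::real_normed_vector \<Rightarrow> 'x) \<Rightarrow> bool" where
  "reflexive_space smul \<longleftrightarrow>
    (\<forall>\<phi> :: ('x \<Rightarrow>\<^sub>L 'f) \<Rightarrow> 'f.
      (\<forall>f\<in>dual_space smul. \<forall>h\<in>dual_space smul. \<phi> (f + h) = \<phi> f + \<phi> h) \<and>
      (\<forall>c. \<forall>f\<in>dual_space smul. \<phi> (functional_scale c f) = c * \<phi> f) \<and>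
      (\<exists>K. \<forall>f\<in>dual_space smul. norm (\<phi> f) \<le> K * norm f)
      \<longrightarrow> (\<exists>x. \<forall>f\<in>dual_space smul. \<phi> f = f x))"

definition strictly_convex_space :: "'x::real_normed_vector itself \<Rightarrow> bool" where
  "strictly_convex_space _ \<longleftrightarrow> (\<forall>x\<in>sphere (0::'x) 1. x extreme_point_of cball 0 1)"

definition functional_kernel :: "('x::real_normed_vector \<Rightarrow>\<^sub>L 'f::real_normed_vector) \<Rightarrow> 'x set" where
  "functional_kernel g = {x. g x = 0}"

definition restriction_norm ::
    "('x::real_normed_vector \<Rightarrow>\<^sub>L 'f::real_normed_vector) \<Rightarrow> 'x set \<Rightarrow> real" where
  "restriction_norm f W = (SUP x\<in>W \<inter> cball 0 1. norm (f x))"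

definition norm_attainment_set ::
    "('x::real_normed_vector \<Rightarrow>\<^sub>L 'f::real_normed_vector) \<Rightarrow> 'x set" where
  "norm_attainment_set f = {x \<in> sphere 0 1. norm (f x) = norm f}"

definition compact_operators ::
    "('f::real_or_complex \<Rightarrow> 'x::real_normed_vector \<Rightarrow> 'x) \<Rightarrow> ('x \<Rightarrow>\<^sub>L ('f, 'd::finite) linf) set" where
  "compact_operators smul =
    {T. Vector_Spaces.linear smul linf_scale (blinfun_apply T) \<and>
        compact (closure (blinfun_apply T ` cball 0 1))}"

lift_definition tuple_operator ::
    "('d::finite \<Rightarrow> ('x::real_normed_vector \<Rightarrow>\<^sub>L 'f::real_normed_vector)) \<Rightarrow> ('x \<Rightarrow>\<^sub>L ('f, 'd) linf)"
  is "\<lambda>f x. Linf (\<lambda>i. blinfun_apply (f i) x)"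
proof -
  fix f :: "'d \<Rightarrow> ('x \<Rightarrow>\<^sub>L 'f)"
  show "bounded_linear (\<lambda>x. Linf (\<lambda>i. blinfun_apply (f i) x))"
  proof (rule bounded_linear_intro)
    fix x
    show "norm (Linf (\<lambda>i. blinfun_apply (f i) x)) \<le> norm x * (\<Sum>i\<in>UNIV. norm (f i))"
    proof (rule linf_norm_le)
      fix i
      have "norm (f i x) \<le> norm (f i) * norm x"
        by (rule norm_blinfun)
      also have "\<dots> \<le> (\<Sum>i\<in>UNIV. norm (f i)) * norm x"
        by (intro mult_right_mono member_le_sum) auto
      finally show "norm (linf_nth (Linf (\<lambda>i. blinfun_apply (f i) x)) i)
          \<le> norm x * (\<Sum>i\<in>UNIV. norm (f i))"
        by (simp add: mult.commute)
    qed
  qed (simp_all add: linf_eq_iff blinfun.bilinear_simps)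
qed

lift_definition operator_scale ::
    "'f::real_or_complex \<Rightarrow> ('x::real_normed_vector \<Rightarrow>\<^sub>L ('f, 'd::finite) linf) \<Rightarrow> ('x \<Rightarrow>\<^sub>L ('f, 'd) linf)"
  is "\<lambda>c T x. linf_scale c (T x)"
proof -
  fix c :: 'f and T :: "'x \<Rightarrow> ('f, 'd) linf"
  assume "bounded_linear T"
  then interpret T: bounded_linear T .
  interpret L: normed_space_over "linf_scale :: 'f \<Rightarrow> ('f, 'd) linf \<Rightarrow> ('f, 'd) linf"
    by (rule normed_space_over_linf_scale)
  obtain K where K: "\<And>x. norm (T x) \<le> norm x * K"
    using T.bounded by blast
  show "bounded_linear (\<lambda>x. linf_scale c (T x))"
  proof (rule bounded_linear_intro)
    fix x
    show "norm (linf_scale c (T x)) \<le> norm x * (norm c * K)"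
      using mult_left_mono[OF K[of x], of "norm c"] by (simp add: L.norm_scale algebra_simps)
  qed (simp_all add: T.add T.scaleR linf_eq_iff linf_scale_def algebra_simps)
qed

definition diagonal_multiples ::
    "('d::finite \<Rightarrow> ('x::real_normed_vector \<Rightarrow>\<^sub>L 'f::real_or_complex)) \<Rightarrow> ('x \<Rightarrow>\<^sub>L ('f, 'd) linf) set" where
  "diagonal_multiples g = {tuple_operator (\<lambda>i. functional_scale (z i) (g i)) | z. True}"

definition BJ_orthogonal ::
    "('f \<Rightarrow> 'v \<Rightarrow> 'v) \<Rightarrow> 'v::real_normed_vector \<Rightarrow> 'v \<Rightarrow> bool" where
  "BJ_orthogonal smul x y \<longleftrightarrow> (\<forall>c. norm (x + smul c y) \<ge> norm x)"

definition BJ_orthogonal_subspace ::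
    "('f \<Rightarrow> 'v \<Rightarrow> 'v) \<Rightarrow> 'v::real_normed_vector \<Rightarrow> 'v set \<Rightarrow> bool" where
  "BJ_orthogonal_subspace smul x W \<longleftrightarrow> (\<forall>w\<in>W. BJ_orthogonal smul x w)"

end

theory Submission
  imports Defs
begin

text \<open>
  The diagonal operators act on the components of \<open>T\<close> independently, and the norm of a tuple is
  the largest norm of a component. Hence the distance from \<open>T\<close> to the diagonal multiples of
  \<open>S\<close> is the largest of the distances from \<open>f\<^sub>i\<close> to the lines \<open>F g\<^sub>i\<close>, taken in the dual space
  (\<open>infdist_diagonal_multiples\<close>). Everything then reduces to one functional \<open>f\<close> and one line \<open>F g\<close>.

  The distance \<open>D\<close> from \<open>f\<close> to \<open>F g\<close> is a seminorm in \<open>f\<close>. By the Hahn-Banach theorem some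
  functional on the dual, dominated by this seminorm, takes the value \<open>D\<close> at \<open>f\<close>; being dominated,
  it vanishes at \<open>g\<close> and has norm at most 1. By reflexivity it is evaluation at a point \<open>x\<close>, and a
  second use of Hahn-Banach gives \<open>norm x \<le> 1\<close>. So \<open>x\<close> lies in the unit ball of the kernel of \<open>g\<close>
  and \<open>f x = D\<close> (\<open>reflexive_distance_attained\<close>). On the other hand, on that unit ball \<open>f\<close> agrees
  with every \<open>f - z g\<close>, so \<open>f\<close> is bounded there by \<open>D\<close>. This yields (i), with the norm of the
  restriction attained.

  For (ii), orthogonality makes the distance equal to the norm of \<open>T\<close>; at an index \<open>i\<close> where the
  maximum is attained, the distance from \<open>f\<^sub>i\<close> to the line is the full norm of \<open>f\<^sub>i\<close>, and the point
  \<open>x\<close> above is a norming point of \<open>f\<^sub>i\<close> in the kernel of \<open>g\<^sub>i\<close>. Strict convexity makes all norming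
  points of \<open>f\<^sub>i\<close> scalar multiples of \<open>x\<close>, so \<open>g\<^sub>i\<close> vanishes at all of them. For the converse in
  (iii), \<open>f\<^sub>i\<close> has a norming point by reflexivity; there \<open>g\<^sub>i\<close> vanishes, so adding a diagonal
  multiple of \<open>S\<close> does not change the \<open>i\<close>-th coordinate of the value of \<open>T\<close>, whose modulus
  at that point is the norm of \<open>T\<close>.
\<close>

section \<open>Minimal sublinear functionals\<close>

definition sublinear :: "('v::real_vector \<Rightarrow> real) \<Rightarrow> bool" where
  "sublinear p \<longleftrightarrow>
    (\<forall>x y. p (x + y) \<le> p x + p y) \<and> (\<forall>r x. 0 \<le> r \<longrightarrow> p (r *\<^sub>R x) = r * p x)"

lemma sublinear_add: "sublinear p \<Longrightarrow> p (x + y) \<le> p x + p y"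
  and sublinear_scale: "sublinear p \<Longrightarrow> 0 \<le> r \<Longrightarrow> p (r *\<^sub>R x) = r * p x"
  by (auto simp: sublinear_def)

lemma sublinear_zero: "sublinear p \<Longrightarrow> p 0 = 0"
  using sublinear_scale[of p 0 0] by simp

lemma sublinear_neg: "sublinear p \<Longrightarrow> - p (- x) \<le> p x"
  using sublinear_add[of p x "- x"] sublinear_zero[of p] by simp

lemma sublinearI:
  assumes add: "\<And>x y. p (x + y) \<le> p x + p y"
    and zero: "p 0 = 0"
    and scale: "\<And>r x. 0 < r \<Longrightarrow> p (r *\<^sub>R x) \<le> r * p x"
  shows "sublinear p"
  unfolding sublinear_def
proof (intro conjI allI impI)
  fix r :: real and x :: 'a
  assume "0 \<le> r"
  show "p (r *\<^sub>R x) = r * p x"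
  proof (cases "r = 0")
    case False
    with \<open>0 \<le> r\<close> have r: "0 < r" by simp
    have "p x \<le> (1 / r) * p (r *\<^sub>R x)"
      using scale[of "1 / r" "r *\<^sub>R x"] r by simp
    then have "r * p x \<le> p (r *\<^sub>R x)"
      using r by (simp add: field_simps)
    with scale[OF r, of x] show ?thesis by simp
  qed (simp add: zero)
qed (rule add)

text \<open>Zorn's lemma is applied below to sublinear functionals ordered downwards, so a chain needs a lower
bound. The pointwise infimum exists because a sublinear \<open>q \<le> p\<close> satisfies \<open>- p (- x) \<le> q x\<close>, and it
is subadditive because the two summands can be bounded through the smaller of two chain members.\<close>

lemma sublinear_INF:
  fixes Q :: "('v::real_vector \<Rightarrow> real) set"
  assumes "Q \<noteq> {}"
    and sub: "\<And>q. q \<in> Q \<Longrightarrow> sublinear q"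
    and chain: "\<And>q q'. q \<in> Q \<Longrightarrow> q' \<in> Q \<Longrightarrow> q \<le> q' \<or> q' \<le> q"
    and below: "\<And>q. q \<in> Q \<Longrightarrow> q \<le> p"
  shows "sublinear (\<lambda>x. INF q\<in>Q. q x)" (is "sublinear ?r")
    and "\<And>q. q \<in> Q \<Longrightarrow> (\<lambda>x. INF q\<in>Q. q x) \<le> q"
proof -
  have bdd: "bdd_below ((\<lambda>q. q x) ` Q)" for x
  proof (rule bdd_belowI2)
    fix q assume "q \<in> Q"
    then show "- p (- x) \<le> q x"
      using sublinear_neg[OF sub, of q x] below[of q] by (auto simp: le_fun_def intro: order_trans[rotated])
  qed
  have lower: "?r x \<le> q x" if "q \<in> Q" for q x
    by (rule cINF_lower[OF bdd that])
  then show "\<And>q. q \<in> Q \<Longrightarrow> ?r \<le> q"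
    by (simp add: le_fun_def)
  show "sublinear ?r"
  proof (rule sublinearI)
    fix x y
    have both: "?r (x + y) \<le> q x + q' y" if "q \<in> Q" "q' \<in> Q" for q q'
    proof -
      have "\<exists>m\<in>Q. m \<le> q \<and> m \<le> q'"
        using chain[OF that] that by blast
      then obtain m where m: "m \<in> Q" "m \<le> q" "m \<le> q'" by blast
      have "?r (x + y) \<le> m x + m y"
        using lower[OF m(1), of "x + y"] sublinear_add[OF sub[OF m(1)], of x y] by simp
      also have "\<dots> \<le> q x + q' y"
        using m by (simp add: le_fun_def add_mono)
      finally show ?thesis .
    qed
    have "?r (x + y) - q x \<le> ?r y" if "q \<in> Q" for q
      using both[OF that] by (intro cINF_greatest \<open>Q \<noteq> {}\<close>) (simp add: algebra_simps)
    then have "?r (x + y) - ?r y \<le> ?r x"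
      by (intro cINF_greatest \<open>Q \<noteq> {}\<close>) (simp add: algebra_simps)
    then show "?r (x + y) \<le> ?r x + ?r y" by simp
  next
    show "?r 0 = 0"
      using \<open>Q \<noteq> {}\<close> by (simp add: sublinear_zero[OF sub] cong: INF_cong)
  next
    fix r :: real and x :: 'v
    assume r: "0 < r"
    have "?r (r *\<^sub>R x) / r \<le> ?r x"
    proof (rule cINF_greatest[OF \<open>Q \<noteq> {}\<close>])
      fix q assume q: "q \<in> Q"
      show "?r (r *\<^sub>R x) / r \<le> q x"
        using lower[OF q, of "r *\<^sub>R x"] r by (simp add: sublinear_scale[OF sub[OF q]] field_simps)
    qed
    then show "?r (r *\<^sub>R x) \<le> r * ?r x"
      using r by (simp add: field_simps)
  qed
qed

text \<open>The tilt of \<open>p\<close> along \<open>y\<close> is the largest sublinear functional below \<open>p\<close> with value at most \<open>- p y\<close>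
at \<open>- y\<close>: it makes \<open>p\<close> linear along the line through \<open>y\<close>. Since it stays below \<open>p\<close>, a minimal
sublinear functional equals all its tilts.\<close>

definition tilt :: "('v::real_vector \<Rightarrow> real) \<Rightarrow> 'v \<Rightarrow> 'v \<Rightarrow> real" where
  "tilt p y x = (INF t\<in>{0..}. p (x + t *\<^sub>R y) - t * p y)"

lemma tilt_lower:
  assumes "sublinear p" "0 \<le> t"
  shows "tilt p y x \<le> p (x + t *\<^sub>R y) - t * p y"
  unfolding tilt_def
proof (rule cINF_lower)
  show "bdd_below ((\<lambda>t. p (x + t *\<^sub>R y) - t * p y) ` {0..})"
  proof (rule bdd_belowI2)
    fix t :: real assume "t \<in> {0..}"
    then show "- p (- x) \<le> p (x + t *\<^sub>R y) - t * p y"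
      using sublinear_add[OF assms(1), of "x + t *\<^sub>R y" "- x"]
      by (simp add: sublinear_scale[OF assms(1)])
  qed
qed (use assms in simp)

lemma tilt_le: "sublinear p \<Longrightarrow> tilt p y x \<le> p x"
  using tilt_lower[of p 0 y x] by simp

lemma sublinear_tilt:
  assumes p: "sublinear p"
  shows "sublinear (tilt p y)"
proof (rule sublinearI)
  fix x x'
  have both: "tilt p y (x + x') \<le> (p (x + s *\<^sub>R y) - s * p y) + (p (x' + t *\<^sub>R y) - t * p y)"
    if "0 \<le> s" "0 \<le> t" for s t
  proof -
    have "tilt p y (x + x') \<le> p (x + x' + (s + t) *\<^sub>R y) - (s + t) * p y"
      using that by (intro tilt_lower p) simp
    also have "p (x + x' + (s + t) *\<^sub>R y) \<le> p (x + s *\<^sub>R y) + p (x' + t *\<^sub>R y)"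
      using sublinear_add[OF p, of "x + s *\<^sub>R y" "x' + t *\<^sub>R y"] by (simp add: algebra_simps)
    finally show ?thesis by (simp add: algebra_simps)
  qed
  have "tilt p y (x + x') - (p (x + s *\<^sub>R y) - s * p y) \<le> tilt p y x'" if "0 \<le> s" for s
    unfolding tilt_def[of p y x']
  proof (rule cINF_greatest)
    fix t :: real assume "t \<in> {0..}"
    then show "tilt p y (x + x') - (p (x + s *\<^sub>R y) - s * p y) \<le> p (x' + t *\<^sub>R y) - t * p y"
      using both[of s t] that by simp
  qed simp
  then have "tilt p y (x + x') - tilt p y x' \<le> tilt p y x"
    unfolding tilt_def[of p y x] by (intro cINF_greatest) (auto simp: algebra_simps)
  then show "tilt p y (x + x') \<le> tilt p y x + tilt p y x'" by simp
next
  show "tilt p y 0 = 0"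
  proof -
    have "p (0 + t *\<^sub>R y) - t * p y = 0" if "t \<in> {0..}" for t
      using that by (simp add: sublinear_scale[OF p])
    then have "tilt p y 0 = (INF t\<in>{0::real..}. 0)"
      unfolding tilt_def by (intro INF_cong) auto
    then show ?thesis by simp
  qed
next
  fix r :: real and x
  assume r: "0 < r"
  have "tilt p y (r *\<^sub>R x) / r \<le> tilt p y x"
    unfolding tilt_def[of p y x]
  proof (rule cINF_greatest)
    fix t :: real assume "t \<in> {0..}"
    then have "tilt p y (r *\<^sub>R x) \<le> p (r *\<^sub>R x + (r * t) *\<^sub>R y) - (r * t) * p y"
      using r by (intro tilt_lower p) simp
    also have "r *\<^sub>R x + (r * t) *\<^sub>R y = r *\<^sub>R (x + t *\<^sub>R y)"
      by (simp add: algebra_simps)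
    also have "p \<dots> = r * p (x + t *\<^sub>R y)"
      using r by (simp add: sublinear_scale[OF p])
    finally show "tilt p y (r *\<^sub>R x) / r \<le> p (x + t *\<^sub>R y) - t * p y"
      using r by (simp add: field_simps)
  qed simp
  then show "tilt p y (r *\<^sub>R x) \<le> r * tilt p y x"
    using r by (simp add: field_simps)
qed

lemma tilt_opposite: "sublinear p \<Longrightarrow> tilt p y (- y) \<le> - p y"
  using tilt_lower[of p 1 y "- y"] sublinear_zero[of p] by simp

text \<open>Equality with its tilts makes \<open>q\<close> odd, and an odd sublinear functional is linear: subadditivity at
the negated arguments is the reverse inequality.\<close>

lemma minimal_sublinear_linear:
  assumes q: "sublinear q"
    and min: "\<And>q'. sublinear q' \<Longrightarrow> q' \<le> q \<Longrightarrow> q' = q"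
  shows "linear q"
proof -
  have neg: "q (- y) = - q y" for y
  proof -
    have "tilt q y = q"
      by (rule min) (simp_all add: sublinear_tilt q le_fun_def tilt_le)
    then show ?thesis
      using tilt_opposite[OF q, of y] sublinear_neg[OF q, of y] sublinear_neg[OF q, of "- y"] by simp
  qed
  show ?thesis
  proof (rule linearI)
    fix x y
    show "q (x + y) = q x + q y"
      using sublinear_add[OF q, of x y] sublinear_add[OF q, of "- x" "- y"]
        neg[of x] neg[of y] neg[of "x + y"] by simp
  next
    fix r :: real and x
    show "q (r *\<^sub>R x) = r *\<^sub>R q x"
    proof (cases "0 \<le> r")
      case False
      then show ?thesis
        using sublinear_scale[OF q, of "- r" x] neg[of "r *\<^sub>R x"] by simp
    qed (simp add: sublinear_scale[OF q])
  qed
qed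

text \<open>The Hahn-Banach theorem for sublinear functionals. The minimal functional is sought below the tilt
of \<open>p\<close> along \<open>v\<close> instead of below \<open>p\<close>, which forces the value \<open>p v\<close> at \<open>v\<close>.\<close>

lemma real_linear_below_sublinear:
  fixes p :: "'v::real_vector \<Rightarrow> real"
  assumes p: "sublinear p"
  obtains \<phi> where "linear \<phi>" "\<And>x. \<phi> x \<le> p x" "\<phi> v = p v"
proof -
  let ?A = "{q. sublinear q \<and> q \<le> tilt p v}"
  have "\<exists>q\<in>?A. \<forall>q'\<in>?A. q' \<le> q \<longrightarrow> q' = q"
  proof (rule predicate_Zorn)
    show "partial_order_on ?A (relation_of (\<lambda>q q'. q' \<le> q) ?A)"
      by (rule partial_order_on_relation_ofI) auto
  next
    fix Q assume "Q \<in> Chains (relation_of (\<lambda>q q'. q' \<le> q) ?A)"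
    then have Q: "\<And>q. q \<in> Q \<Longrightarrow> q \<in> ?A"
      and chain: "\<And>q q'. q \<in> Q \<Longrightarrow> q' \<in> Q \<Longrightarrow> q \<le> q' \<or> q' \<le> q"
      unfolding Chains_def relation_of_def by blast+
    show "\<exists>u\<in>?A. \<forall>q\<in>Q. u \<le> q"
    proof (cases "Q = {}")
      case True
      then show ?thesis using sublinear_tilt[OF p, of v] by auto
    next
      case False
      then obtain q0 where q0: "q0 \<in> Q" by blast
      have sub: "\<And>q. q \<in> Q \<Longrightarrow> sublinear q" and below: "\<And>q. q \<in> Q \<Longrightarrow> q \<le> tilt p v"
        using Q by auto
      let ?u = "\<lambda>x. INF q\<in>Q. q x"
      have lower: "?u \<le> q" if "q \<in> Q" for q
        using False sub chain below that by (rule sublinear_INF(2))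
      have "sublinear ?u"
        using False sub chain below by (rule sublinear_INF(1))
      moreover have "?u \<le> tilt p v"
        using lower[OF q0] below[OF q0] by (rule order_trans)
      ultimately show ?thesis using lower by blast
    qed
  qed
  then obtain q where q: "sublinear q" "q \<le> tilt p v"
    and min: "\<And>q'. sublinear q' \<Longrightarrow> q' \<le> q \<Longrightarrow> q' = q"
    by (smt (verit, best) mem_Collect_eq order_trans)
  have "q x \<le> p x" for x
    using q(2) tilt_le[OF p, of v x] by (meson le_funD order_trans)
  moreover have "q v = p v"
  proof -
    have "q (- v) \<le> - p v"
      using q(2) tilt_opposite[OF p, of v] by (meson le_funD order_trans)
    then show ?thesis
      using sublinear_neg[OF q(1), of v] \<open>q v \<le> p v\<close> by simp
  qed
  ultimately show ?thesis
    using that minimal_sublinear_linear[OF q(1) min] by blast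
qed

section \<open>Functionals over the scalar field\<close>

lemma exists_nearly_closest:
  fixes W :: "'v::real_normed_vector set"
  assumes "W \<noteq> {}" "infdist x W < r"
  obtains w where "w \<in> W" "norm (x - w) < r"
  using assms cInf_lessD[of "(\<lambda>w. dist x w) ` W" r]
  by (auto simp: infdist_notempty dist_norm)

context normed_space_over
begin

text \<open>In the complex case, a real-linear \<open>\<phi>\<close> is the real part of exactly one complex-linear functional,
\<open>\<Phi> x = \<phi> x - i \<phi> (i x)\<close>. The seminorm bound for \<open>\<Phi>\<close> at \<open>x\<close> follows from the one for \<open>\<phi>\<close> after
rotating \<open>x\<close> by a scalar of modulus 1 that makes \<open>\<Phi> x\<close> real and nonnegative.\<close>

lemma functional_below_seminorm:
  fixes p :: "'x \<Rightarrow> real"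
  assumes add: "\<And>x y. p (x + y) \<le> p x + p y"
    and scale: "\<And>c x. p (smul c x) = norm c * p x"
  obtains \<Phi> where "Vector_Spaces.linear smul (*) \<Phi>" "\<And>x. norm (\<Phi> x) \<le> p x"
    "\<Phi> v = of_real (p v)"
proof -
  have scaleR: "p (r *\<^sub>R x) = \<bar>r\<bar> * p x" for r x
    using scale[of "of_real r" x] by (simp add: scale_of_real)
  have "sublinear p"
    by (rule sublinearI) (use add scaleR[of 0 0] scaleR in auto)
  then obtain \<phi> where "linear \<phi>" and below: "\<And>x. \<phi> x \<le> p x" and \<phi>v: "\<phi> v = p v"
    by (metis real_linear_below_sublinear)
  interpret \<phi>: linear \<phi> by fact
  have F: "vector_space ((*) :: 'f \<Rightarrow> 'f \<Rightarrow> 'f)"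
    using normed_space_over_mult by (rule normed_space_over.axioms(1))
  have abs_below: "\<bar>\<phi> x\<bar> \<le> p x" for x
    using below[of x] below[of "- x"] scaleR[of "- 1" x] by (simp add: \<phi>.neg)
  consider (real) "\<And>z::'f. \<exists>a. z = of_real a"
    | (complex) i :: 'f where "i * i = - 1" "\<And>z. \<exists>a b. z = of_real a + of_real b * i"
        "\<And>a b. norm (of_real a + of_real b * i) = sqrt (a\<^sup>2 + b\<^sup>2)"
    using real_or_complex[where 'a='f] by (auto simp: scaleR_conv_of_real)
  then show ?thesis
  proof cases
    case real
    have "Vector_Spaces.linear smul (*) (\<lambda>x. of_real (\<phi> x))"
      unfolding Vector_Spaces.linear_iff
    proof (intro conjI allI)
      fix c :: 'f and x
      obtain a where "c = of_real a" using real by blast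
      then show "of_real (\<phi> (smul c x)) = c * of_real (\<phi> x)"
        by (simp add: scale_of_real \<phi>.scaleR)
    qed (simp_all add: F \<phi>.add vector_space_axioms)
    then show ?thesis
      by (rule that) (simp_all add: abs_below \<phi>v)
  next
    case complex
    define \<Phi> where "\<Phi> x = of_real (\<phi> x) + of_real (- \<phi> (smul i x)) * i" for x
    have \<Phi>_add: "\<Phi> (x + y) = \<Phi> x + \<Phi> y" for x y
      by (simp add: \<Phi>_def \<phi>.add scale_right_distrib algebra_simps)
    have \<Phi>_i: "\<Phi> (smul i x) = i * \<Phi> x" for x
    proof -
      have "smul i (smul i x) = - x"
        by (simp add: complex(1))
      moreover have ii: "i * (i * z) = - z" for z
        using complex(1) by (simp flip: mult.assoc)
      ultimately show ?thesis
        by (simp add: \<Phi>_def \<phi>.neg algebra_simps ii)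
    qed
    have \<Phi>_real: "\<Phi> (smul (of_real a) x) = of_real a * \<Phi> x" for a x
    proof -
      have "smul i (a *\<^sub>R x) = a *\<^sub>R smul i x"
        by (simp flip: scale_of_real add: mult.commute)
      then show ?thesis
        by (simp add: \<Phi>_def scale_of_real \<phi>.scaleR algebra_simps)
    qed
    have \<Phi>_scale: "\<Phi> (smul c x) = c * \<Phi> x" for c x
    proof -
      obtain a b where c: "c = of_real a + of_real b * i" using complex(2) by blast
      have "smul c x = smul (of_real a) x + smul (of_real b) (smul i x)"
        by (simp add: c scale_left_distrib)
      then show ?thesis
        by (simp only: \<Phi>_add \<Phi>_real \<Phi>_i) (simp add: c algebra_simps)
    qed
    have lin: "Vector_Spaces.linear smul (*) \<Phi>"
      by (simp add: Vector_Spaces.linear_iff \<Phi>_add \<Phi>_scale F vector_space_axioms)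
    have bound: "norm (\<Phi> x) \<le> p x" for x
    proof (cases "\<Phi> x = 0")
      case True
      then show ?thesis using abs_below[of x] by simp
    next
      case False
      define c where "c = of_real (norm (\<Phi> x)) / \<Phi> x"
      have "\<Phi> (smul c x) = of_real (norm (\<Phi> x))"
        using False by (simp add: \<Phi>_scale c_def)
      then have "of_real (\<phi> (smul c x)) + of_real (- \<phi> (smul i (smul c x))) * i = of_real (norm (\<Phi> x))"
        unfolding \<Phi>_def[of "smul c x"] .
      then have "of_real (\<phi> (smul c x) - norm (\<Phi> x)) + of_real (- \<phi> (smul i (smul c x))) * i = (0::'f)"
        by (simp add: algebra_simps)
      then have "sqrt ((\<phi> (smul c x) - norm (\<Phi> x))\<^sup>2 + (- \<phi> (smul i (smul c x)))\<^sup>2) = 0"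
        by (metis complex(3) norm_zero)
      then have "norm (\<Phi> x) = \<phi> (smul c x)"
        by (simp add: sum_power2_eq_zero_iff)
      also have "\<dots> \<le> p (smul c x)" by (rule below)
      also have "\<dots> = p x" using False by (simp add: scale c_def norm_divide)
      finally show ?thesis .
    qed
    \<comment> \<open>The real part of \<open>\<Phi> v\<close> already has modulus \<open>p v\<close>, which leaves no room for an imaginary part.\<close>
    have "sqrt ((p v)\<^sup>2 + (- \<phi> (smul i v))\<^sup>2) \<le> p v"
      using bound[of v] unfolding \<Phi>_def complex(3) \<phi>v .
    then have "(p v)\<^sup>2 + (\<phi> (smul i v))\<^sup>2 \<le> (p v)\<^sup>2"
      by (metis power2_minus sqrt_le_D)
    then have "\<Phi> v = of_real (p v)"
      by (simp add: \<Phi>_def \<phi>v)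
    with lin bound show ?thesis by (rule that)
  qed
qed

lemma infdist_subspace_add:
  assumes W: "subspace W"
  shows "infdist (x + y) W \<le> infdist x W + infdist y W"
proof (rule field_le_epsilon)
  fix e :: real
  assume "0 < e"
  have "W \<noteq> {}" using subspace_0[OF W] by blast
  obtain u where u: "u \<in> W" "norm (x - u) < infdist x W + e / 2"
    using \<open>0 < e\<close> by (elim exists_nearly_closest[OF \<open>W \<noteq> {}\<close>, rotated]) auto
  obtain v where v: "v \<in> W" "norm (y - v) < infdist y W + e / 2"
    using \<open>0 < e\<close> by (elim exists_nearly_closest[OF \<open>W \<noteq> {}\<close>, rotated]) auto
  have "infdist (x + y) W \<le> norm ((x - u) + (y - v))"
    using infdist_le[OF subspace_add[OF W u(1) v(1)], of "x + y"]
    by (simp add: dist_norm algebra_simps)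
  also have "\<dots> \<le> norm (x - u) + norm (y - v)"
    by (rule norm_triangle_ineq)
  finally show "infdist (x + y) W \<le> infdist x W + infdist y W + e"
    using u v by simp
qed

lemma infdist_subspace_scale:
  assumes W: "subspace W"
  shows "infdist (smul c x) W = norm c * infdist x W"
proof -
  have le: "infdist (smul c x) W \<le> norm c * infdist x W" if "c \<noteq> 0" for c x
  proof -
    have "infdist (smul c x) W / norm c \<le> infdist x W"
      unfolding infdist_notempty[OF ex_in_conv[THEN iffD1, OF exI, OF subspace_0[OF W]], of x]
    proof (rule cINF_greatest)
      fix w assume w: "w \<in> W"
      have "infdist (smul c x) W \<le> norm (smul c (x - w))"
        using infdist_le[OF subspace_scale[OF W w, of c], of "smul c x"] by (simp add: dist_norm scale_right_diff_distrib)
      also have "\<dots> = norm c * norm (x - w)"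
        by (rule norm_scale)
      finally show "infdist (smul c x) W / norm c \<le> dist x w"
        using that by (simp add: dist_norm field_simps)
    qed (use subspace_0[OF W] in blast)
    then show ?thesis using that by (simp add: field_simps)
  qed
  show ?thesis
  proof (cases "c = 0")
    case True
    then show ?thesis using subspace_0[OF W] by simp
  next
    case False
    have "infdist x W \<le> infdist (smul c x) W / norm c"
      using le[of "inverse c" "smul c x"] False by (simp add: norm_divide inverse_eq_divide)
    then show ?thesis using le[OF False, of x] False by (simp add: field_simps)
  qed
qed

text \<open>The distance to \<open>W\<close> is a seminorm that vanishes on \<open>W\<close> and is at most the norm. A functional
dominated by it inherits both properties.\<close>

lemma functional_attaining_distance:
  assumes W: "subspace W"
  obtains \<Phi> where "Vector_Spaces.linear smul (*) \<Phi>" "\<And>x. norm (\<Phi> x) \<le> norm x"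
    "\<And>w. w \<in> W \<Longrightarrow> \<Phi> w = 0" "\<Phi> v = of_real (infdist v W)"
proof -
  obtain \<Phi> where \<Phi>: "Vector_Spaces.linear smul (*) \<Phi>" "\<Phi> v = of_real (infdist v W)"
    and le: "\<And>x. norm (\<Phi> x) \<le> infdist x W"
    using functional_below_seminorm[of "\<lambda>x. infdist x W" v]
      infdist_subspace_add[OF W] infdist_subspace_scale[OF W] by metis
  show ?thesis
  proof (rule that[OF \<Phi>(1) _ _ \<Phi>(2)])
    show "norm (\<Phi> x) \<le> norm x" for x
      using le[of x] infdist_le[OF subspace_0[OF W], of x] by simp
    show "\<Phi> w = 0" if "w \<in> W" for w
      using le[of w] that by simp
  qed
qed

lemma bounded_linear_functional:
  assumes "Vector_Spaces.linear smul (*) \<Phi>" "\<And>x. norm (\<Phi> x) \<le> norm x * K"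
  shows "bounded_linear \<Phi>"
proof (rule bounded_linear_intro)
  show "\<Phi> (r *\<^sub>R x) = r *\<^sub>R \<Phi> x" for r x
    using assms(1) by (simp add: Vector_Spaces.linear_iff scaleR_conv_of_real flip: scale_of_real)
qed (use assms in \<open>simp_all add: Vector_Spaces.linear_iff\<close>)

lemma subspace_line: "subspace (range (\<lambda>z. smul z w))"
proof -
  have "range (\<lambda>z. smul z w) = span {w}"
    by (simp add: span_singleton)
  then show ?thesis by simp
qed

end

section \<open>The distance to a line in the dual space\<close>

lemma functional_scale_apply [simp]: "functional_scale c f x = c * f x"
  by (simp add: functional_scale_def)

lemma normed_space_over_functional_scale:
  "normed_space_over (functional_scale :: 'f::real_or_complex \<Rightarrow> ('x::real_normed_vector \<Rightarrow>\<^sub>L 'f) \<Rightarrow> _)"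
proof unfold_locales
  fix c :: 'f and f :: "'x \<Rightarrow>\<^sub>L 'f"
  have le: "norm (functional_scale c f) \<le> norm c * norm f" for c :: 'f and f :: "'x \<Rightarrow>\<^sub>L 'f"
  proof (rule norm_blinfun_bound)
    show "norm (functional_scale c f x) \<le> norm c * norm f * norm x" for x
      using mult_left_mono[OF norm_blinfun[of f x], of "norm c"] by (simp add: norm_mult algebra_simps)
  qed simp
  show "norm (functional_scale c f) = norm c * norm f"
  proof (cases "c = 0")
    case False
    have "functional_scale (inverse c) (functional_scale c f) = f"
      using False by (intro blinfun_eqI) simp
    then show ?thesis
      using le[of c f] le[of "inverse c" "functional_scale c f"] False
      by (simp add: norm_divide inverse_eq_divide field_simps)
  qed (use le[of 0 f] in simp)
qed (auto intro!: blinfun_eqI simp: blinfun.bilinear_simps algebra_simps scaleR_conv_of_real)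

text \<open>Reflexivity turns a functional on the dual that attains the distance into a point \<open>x\<close>. Its norm is
controlled by a functional \<open>\<psi>\<close> on the space itself that norms \<open>x\<close>.\<close>

lemma reflexive_distance_attained:
  fixes smul :: "'f::real_or_complex \<Rightarrow> 'x::real_normed_vector \<Rightarrow> 'x"
  assumes X: "normed_space_over smul" and refl: "reflexive_space smul"
    and W: "module.subspace functional_scale W" "W \<subseteq> dual_space smul"
    and f: "f \<in> dual_space smul"
  obtains x where "norm x \<le> 1" "\<And>g. g \<in> W \<Longrightarrow> g x = 0" "f x = of_real (infdist f W)"
proof -
  interpret X: normed_space_over smul by fact
  interpret D: normed_space_over "functional_scale :: 'f \<Rightarrow> ('x \<Rightarrow>\<^sub>L 'f) \<Rightarrow> _"
    by (rule normed_space_over_functional_scale)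
  obtain \<Phi> :: "('x \<Rightarrow>\<^sub>L 'f) \<Rightarrow> 'f" where \<Phi>: "Vector_Spaces.linear functional_scale (*) \<Phi>"
    and bound: "\<And>h. norm (\<Phi> h) \<le> norm h"
    and zero: "\<And>g. g \<in> W \<Longrightarrow> \<Phi> g = 0" and \<Phi>f: "\<Phi> f = of_real (infdist f W)"
    using D.functional_attaining_distance[OF W(1), of f] by metis
  have "\<exists>K. \<forall>h\<in>dual_space smul. norm (\<Phi> h) \<le> K * norm h"
    using bound by (intro exI[of _ 1]) simp
  then obtain x where x: "\<And>h. h \<in> dual_space smul \<Longrightarrow> \<Phi> h = h x"
    using refl \<Phi> unfolding reflexive_space_def Vector_Spaces.linear_iff by metis
  have "norm x \<le> 1"
  proof -
    obtain \<psi> where \<psi>: "Vector_Spaces.linear smul (*) \<psi>" "\<And>y. norm (\<psi> y) \<le> norm y"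
      and \<psi>x: "\<psi> x = of_real (norm x)"
      using X.functional_attaining_distance[OF X.subspace_single_0, of x] by auto
    have app: "blinfun_apply (Blinfun \<psi>) = \<psi>"
      by (intro bounded_linear_Blinfun_apply X.bounded_linear_functional[where K=1]) (use \<psi> in auto)
    then have "norm (Blinfun \<psi>) \<le> 1"
      by (intro norm_blinfun_bound) (simp_all add: \<psi>)
    moreover have "\<Phi> (Blinfun \<psi>) = \<psi> x"
      using x[of "Blinfun \<psi>"] \<psi>(1) by (simp add: dual_space_def app)
    ultimately show ?thesis
      using bound[of "Blinfun \<psi>"] by (simp add: \<psi>x)
  qed
  then show ?thesis
    using that x zero \<Phi>f f W(2) by (metis subsetD)
qed

lemma functional_scale_dual_space:
  assumes "g \<in> dual_space smul"
  shows "functional_scale z g \<in> dual_space smul"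
  using assms by (auto simp: dual_space_def Vector_Spaces.linear_iff algebra_simps)

text \<open>On the kernel of \<open>g\<close>, the functional \<open>f\<close> agrees with every \<open>f - z g\<close>.\<close>

lemma norm_le_infdist_line:
  fixes f g :: "'x::real_normed_vector \<Rightarrow>\<^sub>L 'f::real_or_complex"
  assumes "g x = 0" "norm x \<le> 1"
  shows "norm (f x) \<le> infdist f (range (\<lambda>z. functional_scale z g))"
proof -
  have "norm (f x) \<le> norm (f - functional_scale z g)" for z
  proof -
    have "norm (f x) = norm ((f - functional_scale z g) x)"
      by (simp add: blinfun.diff_left assms)
    also have "\<dots> \<le> norm (f - functional_scale z g) * norm x"
      by (rule norm_blinfun)
    also have "\<dots> \<le> norm (f - functional_scale z g)"
      using assms by (simp add: mult_left_le)
    finally show ?thesis .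
  qed
  then show ?thesis
    by (auto simp: infdist_notempty dist_norm intro!: cINF_greatest)
qed

lemma reflexive_line_distance_attained:
  assumes "normed_space_over smul" "reflexive_space smul"
    and "f \<in> dual_space smul" "g \<in> dual_space smul"
  obtains x where "norm x \<le> 1" "g x = 0"
    "norm (f x) = infdist f (range (\<lambda>z. functional_scale z g))"
proof -
  let ?W = "range (\<lambda>z. functional_scale z g)"
  have "?W \<subseteq> dual_space smul"
    using functional_scale_dual_space[OF assms(4)] by blast
  then obtain x where x: "norm x \<le> 1" "\<And>h. h \<in> ?W \<Longrightarrow> h x = 0" "f x = of_real (infdist f ?W)"
    using assms normed_space_over.subspace_line[OF normed_space_over_functional_scale]
    by (metis reflexive_distance_attained)
  have "g x = 0"
    using x(2)[of "functional_scale 1 g"] by simp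
  moreover have "norm (f x) = infdist f ?W"
    by (simp add: x(3) infdist_nonneg)
  ultimately show ?thesis by (rule that[OF x(1)])
qed

lemma infdist_line_eq_restriction_norm:
  assumes "normed_space_over smul" "reflexive_space smul"
    and "f \<in> dual_space smul" "g \<in> dual_space smul"
  shows "infdist f (range (\<lambda>z. functional_scale z g)) = restriction_norm f (functional_kernel g)"
proof (rule antisym)
  let ?K = "functional_kernel g \<inter> cball 0 1"
  have le: "norm (f x) \<le> infdist f (range (\<lambda>z. functional_scale z g))" if "x \<in> ?K" for x
    using that by (intro norm_le_infdist_line) (auto simp: functional_kernel_def)
  obtain x where x: "norm x \<le> 1" "g x = 0"
    "norm (f x) = infdist f (range (\<lambda>z. functional_scale z g))"
    using reflexive_line_distance_attained[OF assms] .
  have "norm (f x) \<le> restriction_norm f (functional_kernel g)"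
    unfolding restriction_norm_def
    by (rule cSUP_upper) (use x le in \<open>auto simp: functional_kernel_def intro!: bdd_aboveI2[where M = "norm (f x)"]\<close>)
  then show "infdist f (range (\<lambda>z. functional_scale z g)) \<le> restriction_norm f (functional_kernel g)"
    by (simp add: x)
  have "0 \<in> ?K" by (simp add: functional_kernel_def)
  then show "restriction_norm f (functional_kernel g) \<le> infdist f (range (\<lambda>z. functional_scale z g))"
    unfolding restriction_norm_def by (intro cSUP_least le) auto
qed

section \<open>Tuples of functionals\<close>

lemma linf_nth_tuple_operator [simp]: "linf_nth (tuple_operator f x) i = f i x"
  by (simp add: tuple_operator.rep_eq)

lemma norm_component_le_tuple_operator: "norm (f i) \<le> norm (tuple_operator f)"
proof (rule norm_blinfun_bound)
  show "norm (f i x) \<le> norm (tuple_operator f) * norm x" for x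
    using linf_norm_nth_le[of "tuple_operator f x" i] norm_blinfun[of "tuple_operator f" x] by simp
qed simp

lemma norm_tuple_operator_le:
  assumes "\<And>i. norm (f i) \<le> c"
  shows "norm (tuple_operator f) \<le> c"
proof (rule norm_blinfun_bound)
  show "0 \<le> c" using assms norm_ge_zero order_trans by blast
  show "norm (tuple_operator f x) \<le> c * norm x" for x
  proof (rule linf_norm_le)
    fix i
    show "norm (linf_nth (tuple_operator f x) i) \<le> c * norm x"
      using norm_blinfun[of "f i" x] mult_right_mono[OF assms[of i] norm_ge_zero[of x]] by simp
  qed
qed

lemma tuple_operator_diff: "tuple_operator f - tuple_operator g = tuple_operator (\<lambda>i. f i - g i)"
  by (intro blinfun_eqI) (simp add: linf_eq_iff blinfun.diff_left)

text \<open>The scalars in a diagonal multiple are chosen separately in each coordinate, so nearly optimal ones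
can be chosen for all coordinates at once.\<close>

lemma infdist_diagonal_multiples:
  "infdist (tuple_operator f) (diagonal_multiples g)
     = (MAX i. infdist (f i) (range (\<lambda>z. functional_scale z (g i))))"
  (is "_ = (MAX i. ?D i)")
proof (rule antisym)
  have ne: "diagonal_multiples g \<noteq> {}" by (auto simp: diagonal_multiples_def)
  have "?D i \<le> infdist (tuple_operator f) (diagonal_multiples g)" for i
    unfolding infdist_notempty[OF ne]
  proof (rule cINF_greatest[OF ne])
    fix w assume "w \<in> diagonal_multiples g"
    then obtain z where w: "w = tuple_operator (\<lambda>i. functional_scale (z i) (g i))"
      by (auto simp: diagonal_multiples_def)
    have "?D i \<le> norm (f i - functional_scale (z i) (g i))"
      using infdist_le[of "functional_scale (z i) (g i)"] by (simp add: dist_norm)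
    also have "\<dots> \<le> dist (tuple_operator f) w"
      unfolding w dist_norm tuple_operator_diff by (rule norm_component_le_tuple_operator)
    finally show "?D i \<le> dist (tuple_operator f) w" .
  qed
  then show "(MAX i. ?D i) \<le> infdist (tuple_operator f) (diagonal_multiples g)" by simp
  show "infdist (tuple_operator f) (diagonal_multiples g) \<le> (MAX i. ?D i)"
  proof (rule field_le_epsilon)
    fix e :: real assume e: "0 < e"
    have "\<exists>z. norm (f i - functional_scale z (g i)) < ?D i + e" for i
      using e exists_nearly_closest[of "range (\<lambda>z. functional_scale z (g i))" "f i" "?D i + e"]
      by auto
    then obtain z where z: "\<And>i. norm (f i - functional_scale (z i) (g i)) < ?D i + e" by metis
    have "infdist (tuple_operator f) (diagonal_multiples g)
        \<le> norm (tuple_operator f - tuple_operator (\<lambda>i. functional_scale (z i) (g i)))"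
      by (subst dist_norm[symmetric], rule infdist_le) (auto simp: diagonal_multiples_def)
    also have "\<dots> \<le> (MAX i. ?D i) + e"
      unfolding tuple_operator_diff
    proof (rule norm_tuple_operator_le)
      fix i
      have "?D i \<le> (MAX i. ?D i)" by (rule Max_ge) auto
      with z[of i] show "norm (f i - functional_scale (z i) (g i)) \<le> (MAX i. ?D i) + e" by linarith
    qed
    finally show "infdist (tuple_operator f) (diagonal_multiples g) \<le> (MAX i. ?D i) + e" .
  qed
qed

section \<open>Norming points and orthogonality\<close>

text \<open>Rotate \<open>x\<close> to a point \<open>u\<close> with \<open>f u = f y\<close>. At the midpoint of \<open>u\<close> and \<open>y\<close> the functional has the
same value, so the midpoint again has norm 1; it is then an extreme point, and \<open>u = y\<close>.\<close>

lemma strictly_convex_norm_attainment: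
  fixes smul :: "'f::real_or_complex \<Rightarrow> 'x::real_normed_vector \<Rightarrow> 'x"
  assumes X: "normed_space_over smul" and sc: "strictly_convex_space TYPE('x)"
    and f: "f \<in> dual_space smul" "f \<noteq> 0"
    and x: "x \<in> norm_attainment_set f" and y: "y \<in> norm_attainment_set f"
  obtains c where "y = smul c x"
proof -
  interpret X: normed_space_over smul by fact
  define u where "u = smul (f y / f x) x"
  have fx: "norm (f x) = norm f" "norm x = 1" and fy: "norm (f y) = norm f" "norm y = 1"
    using x y by (auto simp: norm_attainment_set_def)
  have "f x \<noteq> 0" using fx f(2) by auto
  then have u: "norm u = 1" "f u = f y"
    using fx fy f by (auto simp: u_def X.norm_scale norm_divide dual_space_def Vector_Spaces.linear_iff)
  define m where "m = (1 / 2) *\<^sub>R (u + y)"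
  have "norm m \<le> 1"
    using norm_triangle_ineq[of u y] by (simp add: m_def u fy)
  moreover have "norm f \<le> norm f * norm m"
  proof -
    have "f m = f y"
      by (simp add: m_def blinfun.bilinear_simps u scaleR_add_right[symmetric] flip: scaleR_2)
    then show ?thesis using norm_blinfun[of f m] fy by simp
  qed
  ultimately have "norm m = 1" using f(2) by simp
  then have "m extreme_point_of cball 0 1"
    using sc by (simp add: strictly_convex_space_def)
  moreover have "m \<in> open_segment u y" if "u \<noteq> y"
  proof -
    have "m = (1 - 1 / 2) *\<^sub>R u + (1 / 2) *\<^sub>R y"
      by (simp add: m_def scaleR_add_right)
    then show ?thesis
      using that unfolding in_segment by (intro conjI exI[of _ "1 / 2"]) simp_all
  qed
  ultimately have "u = y"
    using u fy by (auto simp: extreme_point_of_def)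
  then show ?thesis using that[of "f y / f x"] by (simp add: u_def)
qed

text \<open>For \<open>g = 0\<close> the distance to the line is \<open>norm f\<close>, so every nonzero functional on a reflexive space
has a norming point.\<close>

lemma reflexive_norm_attained:
  assumes "normed_space_over smul" "reflexive_space smul" "f \<in> dual_space smul" "f \<noteq> 0"
    "g \<in> dual_space smul" "norm f \<le> infdist f (range (\<lambda>z. functional_scale z g))"
  obtains x where "x \<in> norm_attainment_set f" "g x = 0"
proof -
  obtain x where x: "norm x \<le> 1" "g x = 0"
    "norm (f x) = infdist f (range (\<lambda>z. functional_scale z g))"
    using reflexive_line_distance_attained[OF assms(1,2,3,5)] .
  have "norm f \<le> norm f * norm x" "norm (f x) \<le> norm f * norm x"
    using x(3) assms(6) norm_blinfun[of f x] by simp_all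
  moreover have "norm f * norm x \<le> norm f" using x(1) by (simp add: mult_left_le)
  ultimately have "norm x = 1" "norm (f x) = norm f"
    using assms(4,6) x(1,3) by auto
  then show ?thesis using that x by (simp add: norm_attainment_set_def)
qed

lemma BJ_orthogonal_imp_norm_le_infdist:
  fixes g :: "'d::finite \<Rightarrow> ('x::real_normed_vector \<Rightarrow>\<^sub>L 'f::real_or_complex)"
  assumes "BJ_orthogonal_subspace operator_scale T (diagonal_multiples g)"
  shows "norm T \<le> infdist T (diagonal_multiples g)"
proof -
  have ne: "diagonal_multiples g \<noteq> {}" by (auto simp: diagonal_multiples_def)
  have "norm T \<le> norm (T - w)" if "w \<in> diagonal_multiples g" for w
  proof -
    have "operator_scale (- 1) w = - w"
      by (intro blinfun_eqI)
        (simp add: operator_scale.rep_eq linf_scale_def linf_eq_iff blinfun.bilinear_simps)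
    moreover have "norm T \<le> norm (T + operator_scale (- 1) w)"
      using assms that by (simp add: BJ_orthogonal_subspace_def BJ_orthogonal_def)
    ultimately show ?thesis by simp
  qed
  then show ?thesis
    unfolding infdist_notempty[OF ne] by (intro cINF_greatest[OF ne]) (simp add: dist_norm)
qed

text \<open>The index is one for which the distance from \<open>f i\<close> to the line through \<open>g i\<close> is largest. By
orthogonality this distance is the norm of the whole tuple, and it is at most the norm of \<open>f i\<close>; so the two agree and
\<open>f i\<close> has a norming point in the kernel of \<open>g i\<close>.\<close>

lemma BJ_orthogonal_imp_vanishes_on_norm_attainment:
  fixes smul :: "'f::real_or_complex \<Rightarrow> 'x::real_normed_vector \<Rightarrow> 'x"
    and f g :: "'d::finite \<Rightarrow> ('x \<Rightarrow>\<^sub>L 'f)"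
  assumes X: "normed_space_over smul" and refl: "reflexive_space smul"
    and sc: "strictly_convex_space TYPE('x)"
    and f: "\<And>i. f i \<in> dual_space smul" and g: "\<And>i. g i \<in> dual_space smul"
    and nz: "tuple_operator f \<noteq> 0"
    and orth: "BJ_orthogonal_subspace operator_scale (tuple_operator f) (diagonal_multiples g)"
  shows "\<exists>i. \<forall>x\<in>norm_attainment_set (f i). g i x = 0"
proof -
  let ?D = "\<lambda>i. infdist (f i) (range (\<lambda>z. functional_scale z (g i)))"
  have "(MAX i. ?D i) \<in> range ?D" by (rule Max_in) auto
  then obtain i where i: "(MAX i. ?D i) = ?D i" by (elim rangeE)
  have large: "norm (tuple_operator f) \<le> ?D i"
    using BJ_orthogonal_imp_norm_le_infdist[OF orth] by (simp add: infdist_diagonal_multiples i)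
  have "functional_scale 0 (g i) = 0"
    by (intro blinfun_eqI) simp
  then have "?D i \<le> norm (f i)"
    using infdist_le[of 0 "range (\<lambda>z. functional_scale z (g i))" "f i"] by (metis dist_0_norm dist_commute rangeI)
  moreover have "0 < norm (tuple_operator f)" using nz by simp
  ultimately have "0 < norm (f i)" using large by linarith
  then have "f i \<noteq> 0" by simp
  have "norm (f i) \<le> ?D i"
    using large norm_component_le_tuple_operator[of f i] by simp
  then obtain x where x: "x \<in> norm_attainment_set (f i)" "g i x = 0"
    using reflexive_norm_attained[OF X refl f \<open>f i \<noteq> 0\<close> g] by blast
  have "g i y = 0" if y: "y \<in> norm_attainment_set (f i)" for y
  proof -
    obtain c where "y = smul c x"
      using strictly_convex_norm_attainment[OF X sc f \<open>f i \<noteq> 0\<close> x(1) y] .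
    then show ?thesis
      using g[of i] x(2) by (simp add: dual_space_def Vector_Spaces.linear_iff)
  qed
  then show ?thesis by blast
qed

text \<open>The \<open>i\<close>-th coordinate of the value at \<open>x\<close> is the same for all perturbations of the tuple by diagonal
multiples, and at \<open>x\<close> its modulus is the norm of the tuple.\<close>

lemma vanishing_at_norming_point_imp_BJ_orthogonal:
  fixes f g :: "'d::finite \<Rightarrow> ('x::real_normed_vector \<Rightarrow>\<^sub>L 'f::real_or_complex)"
  assumes "x \<in> norm_attainment_set (f i)" "g i x = 0" "norm (tuple_operator f) = norm (f i)"
  shows "BJ_orthogonal_subspace operator_scale (tuple_operator f) (diagonal_multiples g)"
  unfolding BJ_orthogonal_subspace_def BJ_orthogonal_def
proof (intro ballI allI)
  fix w c
  assume "w \<in> diagonal_multiples g"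
  then obtain z where w: "w = tuple_operator (\<lambda>i. functional_scale (z i) (g i))"
    by (auto simp: diagonal_multiples_def)
  let ?R = "tuple_operator f + operator_scale c w"
  have x: "norm x = 1" "norm (f i x) = norm (f i)"
    using assms(1) by (auto simp: norm_attainment_set_def)
  have "linf_nth (?R x) i = f i x"
    by (simp add: blinfun.add_left operator_scale.rep_eq linf_scale_def w assms(2))
  then show "norm (tuple_operator f) \<le> norm ?R"
    using linf_norm_nth_le[of "?R x" i] norm_blinfun[of ?R x] by (simp add: x assms(3))
qed

theorem corollary2p13:
  fixes smul :: "'f::real_or_complex \<Rightarrow> 'x::banach \<Rightarrow> 'x"
    and f g :: "'d::finite \<Rightarrow> ('x \<Rightarrow>\<^sub>L 'f)"
    and T S :: "'x \<Rightarrow>\<^sub>L ('f, 'd) linf"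
  assumes "normed_space_over smul"
    and "reflexive_space smul"
    and "strictly_convex_space TYPE('x)"
    and "T \<in> compact_operators smul"
    and "S \<in> compact_operators smul"
    and "\<And>i. f i \<in> dual_space smul"
    and "\<And>i. g i \<in> dual_space smul"
    and "T = tuple_operator f"
    and "S = tuple_operator g"
  shows "infdist T (diagonal_multiples g)
           = (MAX i. restriction_norm (f i) (functional_kernel (g i)))
    \<and> (norm T \<noteq> 0 \<longrightarrow>
         BJ_orthogonal_subspace operator_scale T (diagonal_multiples g) \<longrightarrow>
         (\<exists>i. \<forall>x\<in>norm_attainment_set (f i). g i x = 0))
    \<and> ((\<exists>l. l \<noteq> 0 \<and> (\<forall>i. norm (f i) = l)) \<longrightarrow>
         (BJ_orthogonal_subspace operator_scale T (diagonal_multiples g) \<longleftrightarrow>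
          (\<exists>i. \<forall>x\<in>norm_attainment_set (f i). g i x = 0)))"
proof (intro conjI impI)
  note X = assms(1) and refl = assms(2) and sc = assms(3) and f = assms(6) and g = assms(7)
    and T = assms(8)
  show "infdist T (diagonal_multiples g) = (MAX i. restriction_norm (f i) (functional_kernel (g i)))"
    by (simp add: T infdist_diagonal_multiples infdist_line_eq_restriction_norm[OF X refl f g])
  have forward: "\<exists>i. \<forall>x\<in>norm_attainment_set (f i). g i x = 0"
    if "norm T \<noteq> 0" "BJ_orthogonal_subspace operator_scale T (diagonal_multiples g)"
    using that unfolding T
    by (intro BJ_orthogonal_imp_vanishes_on_norm_attainment[where f=f and g=g, OF X refl sc f g]) auto
  then show "norm T \<noteq> 0 \<Longrightarrow> BJ_orthogonal_subspace operator_scale T (diagonal_multiples g) \<Longrightarrow>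
      \<exists>i. \<forall>x\<in>norm_attainment_set (f i). g i x = 0" .
  assume "\<exists>l. l \<noteq> 0 \<and> (\<forall>i. norm (f i) = l)"
  then obtain l where "l \<noteq> 0" and l: "\<And>i. norm (f i) = l" by blast
  have norm_T: "norm T = l"
    using norm_component_le_tuple_operator[of f undefined] norm_tuple_operator_le[of f l] by (simp add: T l)
  show "BJ_orthogonal_subspace operator_scale T (diagonal_multiples g) \<longleftrightarrow>
      (\<exists>i. \<forall>x\<in>norm_attainment_set (f i). g i x = 0)"
  proof
    assume "\<exists>i. \<forall>x\<in>norm_attainment_set (f i). g i x = 0"
    then obtain i where i: "\<And>x. x \<in> norm_attainment_set (f i) \<Longrightarrow> g i x = 0" by blast
    have "f i \<noteq> 0" using l[of i] \<open>l \<noteq> 0\<close> by auto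
    \<comment> \<open>The hypothesis on \<open>g i\<close> only says something if \<open>f i\<close> has a norming point at all.\<close>
    have "0 \<in> dual_space smul"
      using g[of i] by (simp add: dual_space_def Vector_Spaces.linear_iff)
    moreover have "range (\<lambda>z. functional_scale z (0 :: 'x \<Rightarrow>\<^sub>L 'f)) = {0}"
      by (auto intro!: blinfun_eqI)
    then have "norm (f i) \<le> infdist (f i) (range (\<lambda>z. functional_scale z (0 :: 'x \<Rightarrow>\<^sub>L 'f)))"
      by simp
    ultimately obtain x where "x \<in> norm_attainment_set (f i)"
      using reflexive_norm_attained[OF X refl f \<open>f i \<noteq> 0\<close>] by blast
    then show "BJ_orthogonal_subspace operator_scale T (diagonal_multiples g)"
      unfolding T using i l norm_T T
      by (intro vanishing_at_norming_point_imp_BJ_orthogonal[of x f i g]) auto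
  qed (use forward norm_T \<open>l \<noteq> 0\<close> in auto)
qed

end
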